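(* For all $x\in(0,1)$, all of the following chains of inequalities hold: $$\frac x3\cdot\frac{\sqrt{1-x^2}+14}{2\sqrt{1-x^2}+3}<\frac13\cdot\frac{x+14\left(\sqrt{x+1}-\sqrt{1-x}\right)}{3+\sqrt{x+1}+\sqrt{1-x}}<\arcsin x<\frac{(41\sqrt2+25)\pi}{782}\cdot\frac{x+14\left(\sqrt{x+1}-\sqrt{1-x}\right)}{3+\sqrt{x+1}+\sqrt{1-x}}<\frac{3\pi x}{28}\cdot\frac{\sqrt{1-x^2}+14}{2\sqrt{1-x^2}+3};$$ $$\frac{3x}{2+\sqrt{1-x^2}}<\frac{6\left(\sqrt{x+1}-\sqrt{1-x}\right)}{4+\sqrt{x+1}+\sqrt{1-x}}<\arcsin x<\frac{(1+2\sqrt2)\pi}{12}\cdot\frac{6\left(\sqrt{x+1}-\sqrt{1-x}\right)}{4+\sqrt{x+1}+\sqrt{1-x}}<\frac{\pi x}{2+\sqrt{1-x^2}};$$ $$\frac{\pi x}{4}\cdot\frac{\sqrt{1-x^2}+2}{2\sqrt{1-x^2}+1}<\frac{(\sqrt2+3)\pi}{14}\cdot\frac{x+2\left(\sqrt{x+1}-\sqrt{1-x}\right)}{1+\sqrt{x+1}+\sqrt{1-x}}<\arcsin x<\frac{x+2\left(\sqrt{x+1}-\sqrt{1-x}\right)}{1+\sqrt{x+1}+\sqrt{1-x}}<x\,\frac{\sqrt{1-x^2}+2}{2\sqrt{1-x^2}+1}.$$ *)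

theory Defs
  imports Complex_Main
begin

end

theory Submission
  imports Defs
begin

text \<open>
  Put \<open>x = sin t\<close> with \<open>0 < t < \<pi>/2\<close>, so that \<open>arcsin x = t\<close>, \<open>sqrt (1 - x\<^sup>2) = cos t\<close> and
  \<open>sqrt (1 + x) \<plusminus> sqrt (1 - x)\<close> is \<open>2 cos (t/2)\<close> or \<open>2 sin (t/2)\<close>. In each chain the outer terms
  become multiples of \<open>f t\<close> and the inner terms multiples of \<open>2 f (t/2)\<close> for one function \<open>f\<close> that
  agrees with the identity to high order at 0; the multipliers involving \<open>\<pi>\<close> are
  \<open>(\<pi>/2) / f (\<pi>/2)\<close> and \<open>(\<pi>/4) / f (\<pi>/4)\<close>, which produce equality at \<open>x = 1\<close>. The second chain
  is the case of the Snell--Cusa function \<open>3 sin t / (2 + cos t)\<close>.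

  Two monotonicity properties then give everything. Suppose \<open>f' 0 = 1\<close> and \<open>f'\<close> decreases. First,
  the secant slope \<open>g t = f t / t\<close> decreases from its limit 1 at 0. Hence
  \<open>g t < g (t/2) < 1\<close>, which is the lower half of the chain, and \<open>g (\<pi>/4) < g (t/2)\<close>, which is the
  upper bound for \<open>t\<close>. Secondly, the ratio \<open>2 f (t/2) / f t\<close> increases with \<open>t\<close>, so it stays below
  its value at \<open>\<pi>/2\<close>, which is the last inequality. If \<open>f'\<close> increases, the chain is reversed. These
  are \<open>concave_halving_chain\<close> and \<open>convex_halving_chain\<close>.

  Both properties are read off from explicit error terms. With \<open>c = cos t\<close>, each \<open>f' t\<close> is 1 plus
  or minus a fraction whose numerator is a power of \<open>1 - c\<close> times a positive factor, and the same
  holds for \<open>2 f (t/2) / f t\<close> with \<open>c = cos (t/2)\<close>. In every case the numerator decreases and the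
  positive denominator increases in \<open>c\<close>, so no further calculus is needed.
\<close>

section \<open>Monotonicity of secant slopes\<close>

lemma secant_slope_strict_decreasing:
  fixes f f' :: "real \<Rightarrow> real"
  assumes der: "\<And>t. 0 \<le> t \<Longrightarrow> t \<le> B \<Longrightarrow> (f has_real_derivative f' t) (at t)"
    and f0: "f 0 = 0"
    and dec: "\<And>a b. 0 \<le> a \<Longrightarrow> a < b \<Longrightarrow> b \<le> B \<Longrightarrow> f' b < f' a"
    and ab: "0 < a" "a < b" "b \<le> B"
  shows "f b / b < f a / a"
proof -
  obtain y where y: "0 < y" "y < a" "f a - f 0 = (a - 0) * f' y"
    using MVT2[of 0 a f f'] der ab by (meson dual_order.trans less_imp_le)
  obtain z where z: "a < z" "z < b" "f b - f a = (b - a) * f' z"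
    using MVT2[of a b f f'] der ab by (meson dual_order.trans less_imp_le)
  have "f' z < f' y"
    using dec[of y z] y z ab by linarith
  then have "(b - a) * f' z < (b - a) * f' y"
    using ab by simp
  then have "f b < b * f' y"
    using y z f0 by (simp add: algebra_simps)
  then show ?thesis
    using y f0 ab by (simp add: field_simps)
qed

lemma below_initial_tangent:
  fixes f f' :: "real \<Rightarrow> real"
  assumes der: "\<And>t. 0 \<le> t \<Longrightarrow> t \<le> B \<Longrightarrow> (f has_real_derivative f' t) (at t)"
    and f0: "f 0 = 0"
    and dec: "\<And>a b. 0 \<le> a \<Longrightarrow> a < b \<Longrightarrow> b \<le> B \<Longrightarrow> f' b < f' a"
    and a: "0 < a" "a \<le> B"
  shows "f a < f' 0 * a"
proof -
  obtain y where y: "0 < y" "y < a" "f a - f 0 = (a - 0) * f' y"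
    using MVT2[of 0 a f f'] der a by (meson dual_order.trans less_imp_le)
  have "f' y < f' 0"
    using dec[of 0 y] y a by simp
  then show ?thesis
    using y f0 a by (simp add: mult.commute)
qed

section \<open>The chain of inequalities for a concave or convex approximation of the identity\<close>

lemma cos_half_quarter_range:
  fixes t :: real
  assumes "0 < t" "t < pi / 2"
  shows "sqrt 2 / 2 < cos (t / 2)" "cos (t / 2) < 1"
proof -
  have "cos (pi / 4) < cos (t / 2)" "cos (t / 2) < cos 0"
    using assms cos_monotone_0_pi[of "t / 2" "pi / 4"] cos_monotone_0_pi[of 0 "t / 2"] by auto
  then show "sqrt 2 / 2 < cos (t / 2)" "cos (t / 2) < 1"
    by (simp_all add: cos_45)
qed

text \<open>
  The function \<open>e\<close> is the relative gain from halving the angle. Since \<open>cos (t/2)\<close> exceeds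
  \<open>cos (\<pi>/4)\<close>, the gain at \<open>t\<close> is less than that at \<open>\<pi>/2\<close>, where \<open>1 + e\<close> is the quotient of the two
  normalizing constants; this gives the last inequality, the one that does not come from the slopes
  \<open>f t / t\<close>.
\<close>

lemma concave_halving_chain:
  fixes f f' e :: "real \<Rightarrow> real"
  assumes der: "\<And>t. 0 \<le> t \<Longrightarrow> t \<le> pi / 2 \<Longrightarrow> (f has_real_derivative f' t) (at t)"
    and f0: "f 0 = 0" "f' 0 = 1"
    and dec: "\<And>a b. 0 \<le> a \<Longrightarrow> a < b \<Longrightarrow> b \<le> pi / 2 \<Longrightarrow> f' b < f' a"
    and pos: "\<And>t. 0 < t \<Longrightarrow> t \<le> pi / 2 \<Longrightarrow> 0 < f t"
    and halving: "\<And>t. 0 < t \<Longrightarrow> t \<le> pi / 2 \<Longrightarrow> 2 * f (t / 2) = (1 + e (cos (t / 2))) * f t"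
    and e_dec: "\<And>a c. sqrt 2 / 2 \<le> a \<Longrightarrow> a < c \<Longrightarrow> c < 1 \<Longrightarrow> e c < e a"
    and t: "0 < t" "t < pi / 2"
  shows "f t < 2 * f (t / 2)"
    and "2 * f (t / 2) < t"
    and "t < pi / 4 / f (pi / 4) * (2 * f (t / 2))"
    and "pi / 4 / f (pi / 4) * (2 * f (t / 2)) < pi / 2 / f (pi / 2) * f t"
proof -
  have slope: "f b / b < f a / a" if "0 < a" "a < b" "b \<le> pi / 2" for a b
    using secant_slope_strict_decreasing[OF der f0(1) dec that] .
  have below: "f a < a" if "0 < a" "a \<le> pi / 2" for a
    using below_initial_tangent[OF der f0(1) dec that] f0(2) by simp
  have q: "0 < f (pi / 4)" "0 < f (pi / 2)"
    by (auto intro!: pos)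
  show "f t < 2 * f (t / 2)"
    using slope[of "t / 2" t] t by (simp add: field_simps)
  show "2 * f (t / 2) < t"
    using below[of "t / 2"] t by simp
  show "t < pi / 4 / f (pi / 4) * (2 * f (t / 2))"
    using slope[of "t / 2" "pi / 4"] t q by (simp add: field_simps)
  have "e (cos (t / 2)) < e (sqrt 2 / 2)"
    using e_dec cos_half_quarter_range[OF t] by simp
  then have "2 * f (t / 2) < (1 + e (sqrt 2 / 2)) * f t"
    using halving[of t] pos[of t] t by simp
  also have "1 + e (sqrt 2 / 2) = 2 * f (pi / 4) / f (pi / 2)"
    using halving[of "pi / 2"] q by (simp add: cos_45 field_simps)
  finally show "pi / 4 / f (pi / 4) * (2 * f (t / 2)) < pi / 2 / f (pi / 2) * f t"
    using q by (simp add: field_simps)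
qed

text \<open>
  The mirror image of the concave case: the slope facts are those of \<open>- f\<close>, and \<open>e\<close> is now the
  relative loss from halving the angle.
\<close>

lemma convex_halving_chain:
  fixes f f' e :: "real \<Rightarrow> real"
  assumes der: "\<And>t. 0 \<le> t \<Longrightarrow> t \<le> pi / 2 \<Longrightarrow> (f has_real_derivative f' t) (at t)"
    and f0: "f 0 = 0" "f' 0 = 1"
    and inc: "\<And>a b. 0 \<le> a \<Longrightarrow> a < b \<Longrightarrow> b \<le> pi / 2 \<Longrightarrow> f' a < f' b"
    and pos: "\<And>t. 0 < t \<Longrightarrow> t \<le> pi / 2 \<Longrightarrow> 0 < f t"
    and halving: "\<And>t. 0 < t \<Longrightarrow> t \<le> pi / 2 \<Longrightarrow> 2 * f (t / 2) = (1 - e (cos (t / 2))) * f t"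
    and e_dec: "\<And>a c. sqrt 2 / 2 \<le> a \<Longrightarrow> a < c \<Longrightarrow> c < 1 \<Longrightarrow> e c < e a"
    and t: "0 < t" "t < pi / 2"
  shows "pi / 2 / f (pi / 2) * f t < pi / 4 / f (pi / 4) * (2 * f (t / 2))"
    and "pi / 4 / f (pi / 4) * (2 * f (t / 2)) < t"
    and "t < 2 * f (t / 2)"
    and "2 * f (t / 2) < f t"
proof -
  have der': "((\<lambda>t. - f t) has_real_derivative - f' t) (at t)" if "0 \<le> t" "t \<le> pi / 2" for t
    using der[OF that] by (rule DERIV_minus)
  have slope: "f a / a < f b / b" if "0 < a" "a < b" "b \<le> pi / 2" for a b
    using secant_slope_strict_decreasing[OF der' _ _ that] f0 inc by simp
  have above: "a < f a" if "0 < a" "a \<le> pi / 2" for a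
    using below_initial_tangent[OF der' _ _ that] f0 inc by simp
  have q: "0 < f (pi / 4)" "0 < f (pi / 2)"
    by (auto intro!: pos)
  show "2 * f (t / 2) < f t"
    using slope[of "t / 2" t] t by (simp add: field_simps)
  show "t < 2 * f (t / 2)"
    using above[of "t / 2"] t by simp
  show "pi / 4 / f (pi / 4) * (2 * f (t / 2)) < t"
    using slope[of "t / 2" "pi / 4"] t q by (simp add: field_simps)
  have "2 * f (pi / 4) / f (pi / 2) = 1 - e (sqrt 2 / 2)"
    using halving[of "pi / 2"] q by (simp add: cos_45 field_simps)
  moreover have "e (cos (t / 2)) < e (sqrt 2 / 2)"
    using e_dec cos_half_quarter_range[OF t] by simp
  then have "(1 - e (sqrt 2 / 2)) * f t < 2 * f (t / 2)"
    using halving[of t] pos[of t] t by simp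
  ultimately have "2 * f (pi / 4) / f (pi / 2) * f t < 2 * f (t / 2)"
    by simp
  then show "pi / 2 / f (pi / 2) * f t < pi / 4 / f (pi / 4) * (2 * f (t / 2))"
    using q by (simp add: field_simps)
qed

section \<open>Three trigonometric approximations of the identity\<close>

definition cusa_low :: "real \<Rightarrow> real" where
  "cusa_low t = 3 * sin t / (2 + cos t)"

text \<open>
  The next two functions have the shape \<open>sin t (cos t + p) / (q cos t + r)\<close> with coefficients for
  which the derivative differs from 1 by a multiple of \<open>(1 - cos t)\<^sup>2\<close> for the first and of
  \<open>(1 - cos t)\<^sup>3\<close> for the second. Their errors at 0 thus have orders \<open>t\<^sup>5\<close> (as for the Snell--Cusa
  function, but from above) and \<open>t\<^sup>7\<close>.
\<close>

definition cusa_up :: "real \<Rightarrow> real" where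
  "cusa_up t = sin t * (cos t + 2) / (2 * cos t + 1)"

definition cusa_sharp :: "real \<Rightarrow> real" where
  "cusa_sharp t = sin t * (cos t + 14) / (3 * (2 * cos t + 3))"

lemma cos_strict_decreasing_quadrant:
  fixes a b :: real
  assumes "0 \<le> a" "a < b" "b \<le> pi / 2"
  shows "0 \<le> cos b" "cos b < cos a" "cos a \<le> 1"
  using assms cos_monotone_0_pi[of a b] cos_ge_zero[of b] by auto

lemma sin_times_sin:
  fixes t y :: real
  shows "sin t * sin t = 1 - cos t * cos t" "sin t * (sin t * y) = (1 - cos t * cos t) * y"
proof -
  show s: "sin t * sin t = 1 - cos t * cos t"
    using sin_cos_squared_add[of t] by (simp add: power2_eq_square)
  show "sin t * (sin t * y) = (1 - cos t * cos t) * y"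
    using s by (metis mult.assoc)
qed

lemma frac_strict_mono_nonneg:
  fixes n m p q :: real
  assumes "0 \<le> n" "n < m" "0 < q" "q \<le> p"
  shows "n / p < m / q"
  using assms by (intro frac_less) auto

text \<open>
  The derivatives are written as 1 plus or minus an error so that their monotonicity in \<open>t\<close>
  is visible: the denominators increase with \<open>cos t\<close>, while the numerators decrease to 0.
\<close>

lemma cusa_low_derivative:
  assumes "0 \<le> t" "t \<le> pi / 2"
  shows "(cusa_low has_real_derivative 1 - (1 - cos t)^2 / (2 + cos t)^2) (at t)"
proof -
  have c: "0 < 2 + cos t"
    using cos_ge_zero[of t] assms by simp
  show ?thesis
    unfolding cusa_low_def [abs_def]
    apply (rule derivative_eq_intros refl)+
    using c apply simp
    using c by (simp add: divide_simps) (simp add: power2_eq_square algebra_simps sin_times_sin)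
qed

lemma cusa_up_derivative:
  assumes "0 \<le> t" "t \<le> pi / 2"
  shows "(cusa_up has_real_derivative
          1 + 2 * ((1 - cos t)^2 * (1 + cos t)) / (2 * cos t + 1)^2) (at t)"
proof -
  have c: "0 < 2 * cos t + 1"
    using cos_ge_zero[of t] assms by simp
  show ?thesis
    unfolding cusa_up_def [abs_def]
    apply (rule derivative_eq_intros refl)+
    using c apply simp
    using c by (simp add: divide_simps) (simp add: power2_eq_square algebra_simps sin_times_sin)
qed

lemma cusa_sharp_derivative:
  assumes "0 \<le> t" "t \<le> pi / 2"
  shows "(cusa_sharp has_real_derivative
          1 - 2 / 3 * (1 - cos t)^3 / (2 * cos t + 3)^2) (at t)"
proof -
  have c: "0 < 2 * cos t + 3"
    using cos_ge_zero[of t] assms by simp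
  show ?thesis
    unfolding cusa_sharp_def [abs_def]
    apply (rule derivative_eq_intros refl)+
    using c apply simp
    using c by (simp add: divide_simps)
      (simp add: power2_eq_square power3_eq_cube algebra_simps sin_times_sin)
qed

text \<open>
  By the double-angle formulas \<open>f t / sin (t/2)\<close> is a rational function of \<open>c = cos (t/2)\<close>, and so is
  the ratio \<open>2 f (t/2) / f t\<close>. Subtracting 1 from it leaves a numerator divisible by the same
  power of \<open>1 - c\<close> as in the derivative, because the errors of \<open>f t\<close> and \<open>2 f (t/2)\<close> at 0 have equal
  order.
\<close>

lemma cusa_low_halving:
  assumes "0 < t" "t \<le> pi / 2"
  shows "2 * cusa_low (t / 2)
       = (1 + (1 - cos (t / 2))^2 / (cos (t / 2) * (2 + cos (t / 2)))) * cusa_low t"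
proof -
  define c s where "c = cos (t / 2)" and "s = sin (t / 2)"
  have c: "0 < c"
    unfolding c_def using assms by (intro cos_gt_zero_pi) auto
  have "sin t = 2 * s * c" "cos t = 2 * c^2 - 1"
    using sin_double[of "t / 2"] cos_double_cos[of "t / 2"] by (simp_all add: c_def s_def)
  moreover have "0 < 2 * c^2 + 1"
    using zero_le_power2[of c] by linarith
  moreover have "0 < 2 + c"
    using c by simp
  ultimately show ?thesis
    unfolding cusa_low_def c_def[symmetric] s_def[symmetric] using c
    by (simp add: divide_simps) (simp add: power2_eq_square algebra_simps)
qed

lemma cusa_up_halving:
  assumes "0 < t" "t \<le> pi / 2"
  shows "2 * cusa_up (t / 2)
       = (1 - 2 * ((1 - cos (t / 2))^2 * (1 + cos (t / 2))) / (cos (t / 2) * (2 * cos (t / 2)^2 + 1)))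
         * cusa_up t"
proof -
  define c s where "c = cos (t / 2)" and "s = sin (t / 2)"
  have c: "0 < c"
    unfolding c_def using assms by (intro cos_gt_zero_pi) auto
  have d: "sin t = 2 * s * c" "cos t = 2 * c^2 - 1"
    using sin_double[of "t / 2"] cos_double_cos[of "t / 2"] by (simp_all add: c_def s_def)
  \<comment> \<open>The common factor \<open>2 c - 1\<close> is positive because \<open>2 cos t + 1\<close> and \<open>2 c + 1\<close> are.\<close>
  have "2 * cos t + 1 = (2 * c + 1) * (2 * c - 1)"
    using d by (simp add: power2_eq_square algebra_simps)
  moreover have "0 < 2 * cos t + 1"
    using cos_ge_zero[of t] assms by simp
  ultimately have "0 < 2 * c - 1"
    using c by (simp add: zero_less_mult_iff)
  moreover have "0 < 2 * c^2 + 1" "0 < 2 * c + 1"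
    using zero_le_power2[of c] c by linarith+
  moreover have full: "cusa_up t = 2 * s * c * (2 * c^2 + 1) / ((2 * c + 1) * (2 * c - 1))"
    unfolding cusa_up_def d by (simp add: power2_eq_square algebra_simps)
  ultimately show ?thesis
    unfolding full cusa_up_def[of "t / 2"] c_def[symmetric] s_def[symmetric] using c
    by (simp add: divide_simps) (simp add: power2_eq_square algebra_simps)
qed

lemma cusa_sharp_halving:
  assumes "0 < t" "t \<le> pi / 2"
  shows "2 * cusa_sharp (t / 2)
       = (1 + 2 * ((1 - cos (t / 2))^2 * ((1 - cos (t / 2)) * (2 * cos (t / 2) + 7)))
              / (cos (t / 2) * (2 * cos (t / 2) + 3) * (2 * cos (t / 2)^2 + 13)))
         * cusa_sharp t"
proof -
  define c s where "c = cos (t / 2)" and "s = sin (t / 2)"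
  have c: "0 < c"
    unfolding c_def using assms by (intro cos_gt_zero_pi) auto
  have d: "sin t = 2 * s * c" "cos t = 2 * c^2 - 1"
    using sin_double[of "t / 2"] cos_double_cos[of "t / 2"] by (simp_all add: c_def s_def)
  have "0 < 4 * c^2 + 1" "0 < 2 * c^2 + 13" "0 < 2 * c + 3"
    using zero_le_power2[of c] c by linarith+
  moreover have full: "cusa_sharp t = 2 * s * c * (2 * c^2 + 13) / (3 * (4 * c^2 + 1))"
    unfolding cusa_sharp_def d by (simp add: algebra_simps)
  ultimately show ?thesis
    unfolding full cusa_sharp_def[of "t / 2"] c_def[symmetric] s_def[symmetric] using c
    by (simp add: divide_simps) (simp add: power2_eq_square algebra_simps)
qed

section \<open>The three chains in terms of the angle\<close>

lemma cusa_low_chain: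
  assumes t: "0 < t" "t < pi / 2"
  shows "cusa_low t < 2 * cusa_low (t / 2)"
    and "2 * cusa_low (t / 2) < t"
    and "t < pi / 4 / cusa_low (pi / 4) * (2 * cusa_low (t / 2))"
    and "pi / 4 / cusa_low (pi / 4) * (2 * cusa_low (t / 2)) < pi / 2 / cusa_low (pi / 2) * cusa_low t"
proof -
  have dec: "1 - (1 - cos b)^2 / (2 + cos b)^2 < 1 - (1 - cos a)^2 / (2 + cos a)^2"
    if "0 \<le> a" "a < b" "b \<le> pi / 2" for a b :: real
    using cos_strict_decreasing_quadrant[OF that]
    by (auto intro!: frac_strict_mono_nonneg power_strict_mono power_mono)
  have pos: "0 < cusa_low t" if "0 < t" "t \<le> pi / 2" for t
    unfolding cusa_low_def using that cos_ge_zero[of t] sin_gt_zero[of t]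
    by (intro divide_pos_pos) auto
  have e_dec: "(1 - c)^2 / (c * (2 + c)) < (1 - a)^2 / (a * (2 + a))"
    if "sqrt 2 / 2 \<le> a" "a < c" "c < 1" for a c :: real
    using that less_le_trans[of 0 "sqrt 2 / 2" a]
    by (auto intro!: frac_strict_mono_nonneg power_strict_mono mult_mono)
  note chain = concave_halving_chain[where f = cusa_low, OF cusa_low_derivative _ _ dec pos cusa_low_halving e_dec t]
  show "cusa_low t < 2 * cusa_low (t / 2)"
    and "2 * cusa_low (t / 2) < t"
    and "t < pi / 4 / cusa_low (pi / 4) * (2 * cusa_low (t / 2))"
    and "pi / 4 / cusa_low (pi / 4) * (2 * cusa_low (t / 2)) < pi / 2 / cusa_low (pi / 2) * cusa_low t"
    by (rule chain; simp add: cusa_low_def)+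
qed

lemma cusa_sharp_chain:
  assumes t: "0 < t" "t < pi / 2"
  shows "cusa_sharp t < 2 * cusa_sharp (t / 2)"
    and "2 * cusa_sharp (t / 2) < t"
    and "t < pi / 4 / cusa_sharp (pi / 4) * (2 * cusa_sharp (t / 2))"
    and "pi / 4 / cusa_sharp (pi / 4) * (2 * cusa_sharp (t / 2)) < pi / 2 / cusa_sharp (pi / 2) * cusa_sharp t"
proof -
  have dec: "1 - 2 / 3 * (1 - cos b)^3 / (2 * cos b + 3)^2 < 1 - 2 / 3 * (1 - cos a)^3 / (2 * cos a + 3)^2"
    if "0 \<le> a" "a < b" "b \<le> pi / 2" for a b :: real
    using cos_strict_decreasing_quadrant[OF that]
    by (intro diff_strict_left_mono frac_strict_mono_nonneg mult_strict_left_mono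
          power_strict_mono power_mono) auto
  have pos: "0 < cusa_sharp t" if "0 < t" "t \<le> pi / 2" for t
    unfolding cusa_sharp_def using that cos_ge_zero[of t] sin_gt_zero[of t]
    by (intro divide_pos_pos mult_pos_pos) auto
  have e_dec: "2 * ((1 - c)^2 * ((1 - c) * (2 * c + 7))) / (c * (2 * c + 3) * (2 * c^2 + 13))
      < 2 * ((1 - a)^2 * ((1 - a) * (2 * a + 7))) / (a * (2 * a + 3) * (2 * a^2 + 13))"
    if "sqrt 2 / 2 \<le> a" "a < c" "c < 1" for a c :: real
  proof -
    have a: "0 < a"
      using that less_le_trans[of 0 "sqrt 2 / 2" a] by simp
    \<comment> \<open>\<open>(1 - c) (2 c + 7)\<close> decreases; the product below is the difference of its values.\<close>
    have "0 < (c - a) * (5 + 2 * (a + c))"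
      using a that by (intro mult_pos_pos) auto
    then have "(1 - c) * (2 * c + 7) < (1 - a) * (2 * a + 7)"
      by (simp add: algebra_simps)
    then have "(1 - c)^2 * ((1 - c) * (2 * c + 7)) < (1 - a)^2 * ((1 - a) * (2 * a + 7))"
      using a that by (intro mult_strict_mono'[OF power_strict_mono]) auto
    moreover have "a * (2 * a + 3) * (2 * a^2 + 13) \<le> c * (2 * c + 3) * (2 * c^2 + 13)"
      using a that by (intro mult_mono add_mono power_mono) auto
    moreover have "0 < a * (2 * a + 3) * (2 * a^2 + 13)"
      using a by (intro mult_pos_pos add_nonneg_pos) auto
    ultimately show ?thesis
      using a that by (intro frac_strict_mono_nonneg mult_nonneg_nonneg mult_strict_left_mono) auto
  qed
  note chain = concave_halving_chain[where f = cusa_sharp, OF cusa_sharp_derivative _ _ dec pos cusa_sharp_halving e_dec t]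
  show "cusa_sharp t < 2 * cusa_sharp (t / 2)"
    and "2 * cusa_sharp (t / 2) < t"
    and "t < pi / 4 / cusa_sharp (pi / 4) * (2 * cusa_sharp (t / 2))"
    and "pi / 4 / cusa_sharp (pi / 4) * (2 * cusa_sharp (t / 2)) < pi / 2 / cusa_sharp (pi / 2) * cusa_sharp t"
    by (rule chain; simp add: cusa_sharp_def)+
qed

lemma cusa_up_chain:
  assumes t: "0 < t" "t < pi / 2"
  shows "pi / 2 / cusa_up (pi / 2) * cusa_up t < pi / 4 / cusa_up (pi / 4) * (2 * cusa_up (t / 2))"
    and "pi / 4 / cusa_up (pi / 4) * (2 * cusa_up (t / 2)) < t"
    and "t < 2 * cusa_up (t / 2)"
    and "2 * cusa_up (t / 2) < cusa_up t"
proof -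
  have num: "(1 - c)^2 * (1 + c) < (1 - a)^2 * (1 + a)" if "0 \<le> a" "a < c" "c \<le> 1" for a c :: real
  proof -
    \<comment> \<open>Regrouping \<open>(1 - c)\<^sup>2 (1 + c) = (1 - c) (1 - c\<^sup>2)\<close> leaves two decreasing factors.\<close>
    have "(1 - c) * (1 - c^2) < (1 - a) * (1 - a^2)"
      using that power_strict_mono[of a c 2] power_le_one[of c 2]
      by (intro mult_strict_mono') auto
    then show ?thesis
      by (simp add: power2_eq_square algebra_simps)
  qed
  have inc: "1 + 2 * ((1 - cos a)^2 * (1 + cos a)) / (2 * cos a + 1)^2
      < 1 + 2 * ((1 - cos b)^2 * (1 + cos b)) / (2 * cos b + 1)^2"
    if "0 \<le> a" "a < b" "b \<le> pi / 2" for a b :: real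
    using cos_strict_decreasing_quadrant[OF that]
    by (intro add_strict_left_mono frac_strict_mono_nonneg mult_strict_left_mono num power_mono) auto
  have pos: "0 < cusa_up t" if "0 < t" "t \<le> pi / 2" for t
    unfolding cusa_up_def using that cos_ge_zero[of t] sin_gt_zero[of t]
    by (intro divide_pos_pos mult_pos_pos) auto
  have e_dec: "2 * ((1 - c)^2 * (1 + c)) / (c * (2 * c^2 + 1)) < 2 * ((1 - a)^2 * (1 + a)) / (a * (2 * a^2 + 1))"
    if "sqrt 2 / 2 \<le> a" "a < c" "c < 1" for a c :: real
    using that less_le_trans[of 0 "sqrt 2 / 2" a]
    by (intro frac_strict_mono_nonneg mult_strict_left_mono num mult_mono add_mono power_mono)
       (auto intro!: mult_pos_pos add_nonneg_pos)
  note chain = convex_halving_chain[where f = cusa_up, OF cusa_up_derivative _ _ inc pos cusa_up_halving e_dec t]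
  show "pi / 2 / cusa_up (pi / 2) * cusa_up t < pi / 4 / cusa_up (pi / 4) * (2 * cusa_up (t / 2))"
    and "pi / 4 / cusa_up (pi / 4) * (2 * cusa_up (t / 2)) < t"
    and "t < 2 * cusa_up (t / 2)"
    and "2 * cusa_up (t / 2) < cusa_up t"
    by (rule chain; simp add: cusa_up_def)+
qed

section \<open>Translation to the inverse sine\<close>

lemma sqrt_one_plus_minus_sin:
  assumes "0 \<le> t" "t \<le> pi / 2"
  shows "sqrt (sin t + 1) = cos (t / 2) + sin (t / 2)"
    and "sqrt (1 - sin t) = cos (t / 2) - sin (t / 2)"
proof -
  have d: "sin t = 2 * sin (t / 2) * cos (t / 2)"
    using sin_double[of "t / 2"] by simp
  have one: "sin (t / 2) * sin (t / 2) + cos (t / 2) * cos (t / 2) = 1"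
    using sin_cos_squared_add[of "t / 2"] by (simp add: power2_eq_square)
  have "0 \<le> sin (t / 2)" "0 \<le> cos (t / 2)"
    using assms by (auto intro!: sin_ge_zero cos_ge_zero)
  moreover have "sin (t / 2) \<le> sin (pi / 4)" "cos (pi / 4) \<le> cos (t / 2)"
    using assms by (auto intro!: sin_monotone_2pi_le cos_monotone_0_pi_le)
  then have "sin (t / 2) \<le> cos (t / 2)"
    by (simp add: sin_45 cos_45)
  moreover have "(cos (t / 2) + sin (t / 2))^2 = sin t + 1" "(cos (t / 2) - sin (t / 2))^2 = 1 - sin t"
    unfolding d using one by (simp_all add: power2_eq_square algebra_simps)
  ultimately show "sqrt (sin t + 1) = cos (t / 2) + sin (t / 2)"
    and "sqrt (1 - sin t) = cos (t / 2) - sin (t / 2)"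
    by (simp_all add: real_sqrt_unique)
qed

text \<open>
  In the last constant, rationalizing the denominator \<open>sqrt 2 + 28\<close> yields \<open>782 = 28\<^sup>2 - 2\<close>. The
  factor 3 is split off because \<open>cusa_sharp\<close> carries a factor \<open>1/3\<close>.
\<close>

lemma normalizing_constants:
  "pi / 2 / cusa_low (pi / 2) = pi / 3"
  "pi / 2 / cusa_up (pi / 2) = pi / 4"
  "pi / 2 / cusa_sharp (pi / 2) = 9 * pi / 28"
  "pi / 4 / cusa_low (pi / 4) = (1 + 2 * sqrt 2) * pi / 12"
  "pi / 4 / cusa_up (pi / 4) = (sqrt 2 + 3) * pi / 14"
  "pi / 4 / cusa_sharp (pi / 4) = 3 * ((41 * sqrt 2 + 25) * pi / 782)"
proof -
  show "pi / 2 / cusa_low (pi / 2) = pi / 3"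
    "pi / 2 / cusa_up (pi / 2) = pi / 4"
    "pi / 2 / cusa_sharp (pi / 2) = 9 * pi / 28"
    by (simp_all add: cusa_low_def cusa_up_def cusa_sharp_def)
  define q where "q = sqrt (2::real)"
  have q: "0 < q" "q * q = 2" "q * (q * y) = 2 * y" for y
    by (simp_all add: q_def mult.assoc[symmetric])
  have n: "4 + q \<noteq> 0" "1 + q \<noteq> 0" "28 + q \<noteq> 0" "3 + q \<noteq> 0" "q + 4 \<noteq> 0" "q + 28 \<noteq> 0" "q + 1 \<noteq> 0" "q + 3 \<noteq> 0"
    using q(1) by linarith+
  show "pi / 4 / cusa_low (pi / 4) = (1 + 2 * sqrt 2) * pi / 12"
    "pi / 4 / cusa_up (pi / 4) = (sqrt 2 + 3) * pi / 14"
    "pi / 4 / cusa_sharp (pi / 4) = 3 * ((41 * sqrt 2 + 25) * pi / 782)"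
    unfolding cusa_low_def cusa_up_def cusa_sharp_def sin_45 cos_45 q_def[symmetric]
    using q n by (simp_all add: field_simps)
qed

theorem proposition3:
  fixes x :: real
  assumes "x \<in> {0<..<1}"
  shows "(x / 3 * ((sqrt (1 - x^2) + 14) / (2 * sqrt (1 - x^2) + 3))
         < 1 / 3 * ((x + 14 * (sqrt (x + 1) - sqrt (1 - x))) / (3 + sqrt (x + 1) + sqrt (1 - x)))
     \<and> 1 / 3 * ((x + 14 * (sqrt (x + 1) - sqrt (1 - x))) / (3 + sqrt (x + 1) + sqrt (1 - x)))
         < arcsin x
     \<and> arcsin x
         < (41 * sqrt 2 + 25) * pi / 782 * ((x + 14 * (sqrt (x + 1) - sqrt (1 - x))) / (3 + sqrt (x + 1) + sqrt (1 - x)))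
     \<and> (41 * sqrt 2 + 25) * pi / 782 * ((x + 14 * (sqrt (x + 1) - sqrt (1 - x))) / (3 + sqrt (x + 1) + sqrt (1 - x)))
         < 3 * pi * x / 28 * ((sqrt (1 - x^2) + 14) / (2 * sqrt (1 - x^2) + 3)))
    \<and> (3 * x / (2 + sqrt (1 - x^2))
         < 6 * (sqrt (x + 1) - sqrt (1 - x)) / (4 + sqrt (x + 1) + sqrt (1 - x))
     \<and> 6 * (sqrt (x + 1) - sqrt (1 - x)) / (4 + sqrt (x + 1) + sqrt (1 - x))
         < arcsin x
     \<and> arcsin x
         < (1 + 2 * sqrt 2) * pi / 12 * (6 * (sqrt (x + 1) - sqrt (1 - x)) / (4 + sqrt (x + 1) + sqrt (1 - x)))
     \<and> (1 + 2 * sqrt 2) * pi / 12 * (6 * (sqrt (x + 1) - sqrt (1 - x)) / (4 + sqrt (x + 1) + sqrt (1 - x)))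
         < pi * x / (2 + sqrt (1 - x^2)))
    \<and> (pi * x / 4 * ((sqrt (1 - x^2) + 2) / (2 * sqrt (1 - x^2) + 1))
         < (sqrt 2 + 3) * pi / 14 * ((x + 2 * (sqrt (x + 1) - sqrt (1 - x))) / (1 + sqrt (x + 1) + sqrt (1 - x)))
     \<and> (sqrt 2 + 3) * pi / 14 * ((x + 2 * (sqrt (x + 1) - sqrt (1 - x))) / (1 + sqrt (x + 1) + sqrt (1 - x)))
         < arcsin x
     \<and> arcsin x
         < (x + 2 * (sqrt (x + 1) - sqrt (1 - x))) / (1 + sqrt (x + 1) + sqrt (1 - x))
     \<and> (x + 2 * (sqrt (x + 1) - sqrt (1 - x))) / (1 + sqrt (x + 1) + sqrt (1 - x))
         < x * ((sqrt (1 - x^2) + 2) / (2 * sqrt (1 - x^2) + 1)))"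
proof -
  define t where "t = arcsin x"
  have x: "0 < x" "x < 1"
    using assms by auto
  have sin_t: "sin t = x"
    using x by (simp add: t_def)
  have t: "0 < t" "t < pi / 2"
    using x arcsin_less_arcsin[of 0 x] arcsin_less_arcsin[of x 1] by (simp_all add: t_def)
  define c s where "c = cos (t / 2)" and "s = sin (t / 2)"
  have w: "sqrt (1 - x^2) = cos t"
    unfolding t_def using x by (simp add: cos_arcsin)
  have uv: "sqrt (x + 1) = c + s" "sqrt (1 - x) = c - s"
    using sqrt_one_plus_minus_sin[of t] t by (simp_all add: sin_t c_def s_def)
  have xsc: "x = 2 * s * c"
    using sin_double[of "t / 2"] sin_t by (simp add: c_def s_def)
  have c: "0 < c"
    unfolding c_def using t by (intro cos_gt_zero_pi) auto
  have full: "cusa_low t = 3 * x / (2 + cos t)"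
    "cusa_up t = x * ((cos t + 2) / (2 * cos t + 1))"
    "cusa_sharp t = x / 3 * ((cos t + 14) / (2 * cos t + 3))"
    by (simp_all add: cusa_low_def cusa_up_def cusa_sharp_def sin_t)
  have "2 * cusa_low (t / 2) = 6 * (2 * s) / (4 + 2 * c)"
    "2 * cusa_up (t / 2) = (x + 2 * (2 * s)) / (1 + 2 * c)"
    "2 * cusa_sharp (t / 2) = 1 / 3 * ((x + 14 * (2 * s)) / (3 + 2 * c))"
    unfolding cusa_low_def cusa_up_def cusa_sharp_def c_def[symmetric] s_def[symmetric] xsc
    using c by (simp_all add: divide_simps) (simp_all add: algebra_simps)?
  then have half:
    "2 * cusa_low (t / 2) = 6 * (sqrt (x + 1) - sqrt (1 - x)) / (4 + sqrt (x + 1) + sqrt (1 - x))"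
    "2 * cusa_up (t / 2) = (x + 2 * (sqrt (x + 1) - sqrt (1 - x))) / (1 + sqrt (x + 1) + sqrt (1 - x))"
    "2 * cusa_sharp (t / 2)
      = 1 / 3 * ((x + 14 * (sqrt (x + 1) - sqrt (1 - x))) / (3 + sqrt (x + 1) + sqrt (1 - x)))"
    by (simp_all add: uv add.assoc)
  have scaling: "pi / 3 * (3 * x / y) = pi * x / y" "pi / 4 * (x * y) = pi * x / 4 * y"
    "9 * pi / 28 * (x / 3 * y) = 3 * pi * x / 28 * y" "3 * k * (1 / 3 * y) = k * y" for k y
    by simp_all
  note low = cusa_low_chain[OF t, unfolded normalizing_constants half full scaling]
  note up = cusa_up_chain[OF t, unfolded normalizing_constants half full scaling]
  note sharp = cusa_sharp_chain[OF t, unfolded normalizing_constants half full scaling]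
  show ?thesis
    unfolding w t_def[symmetric]
    by (intro conjI low up sharp)
qed

end
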